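(* If $Y$ is a convergence-approach space that is not $\oplus$-regular, then there are a $\oplus$-approach space $X$, a (uniformly $\oplus$-strict) subspace $S$ of $X$, a contraction $f:S\to Y$, an $\alpha\in[0,\infty)$, and an admissible extension $g:h(S,f,\alpha)\to Y$ of $f$ that is not a contraction.
   Context: Filters are proper. $\mathbb{F}X$ is the set of filters on $X$, ordered by inclusion ($\mathcal{F}\le\mathcal{G}$ iff $\mathcal{F}\subseteq\mathcal{G}$); $\mathbb{U}X$ is the set of ultrafilters; $\mathcal{F}\wedge\mathcal{G}=\mathcal{F}\cap\mathcal{G}$; $\mathcal{A}^{\uparrow}=\{B\subseteq X:\exists A\in\mathcal{A},\ A\subseteq B\}$; $\{x\}^{\uparrow}$ is the principal ultrafilter at $x$. A filter base is identified with the filter it generates, and a filter on a subset of $X$ is identified with the filter it generates on $X$ where needed. $f[\mathcal{F}]=\{f(F):F\in\mathcal{F}\}^{\uparrow}$. For $\mathcal{F}\in\mathbb{F}X$ and $\mathcal{S}:X\to\mathbb{F}Y$, $\mathcal{S}(\mathcal{F})=\bigcup_{F\in\mathcal{F}}\bigcap_{x\in F}\mathcal{S}(x)$, a filter on $Y$. A convergence-approach space (CAP space) is a pair $(X,\lambda_X)$ with $\lambda_X:\mathbb{F}X\to[0,\infty]^{X}$ (ordered pointwise) such that $\lambda_X(\mathcal{F}\wedge\mathcal{G})=\lambda_X(\mathcal{F})\vee\lambda_X(\mathcal{G})$ for all $\mathcal{F},\mathcal{G}\in\mathbb{F}X$ and $\lambda_X(\{x\}^{\uparrow})(x)=0$ for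 all $x\in X$. A subset $S\subseteq X$ carries the subspace (initial) structure $\lambda_S(\mathcal{F})(x)=\lambda_X(\mathcal{F}^{\uparrow})(x)$. A map $f:X\to Y$ between CAP spaces is a contraction if $\lambda_Y(f[\mathcal{F}])\circ f\le\lambda_X(\mathcal{F})$ for every $\mathcal{F}\in\mathbb{F}X$. $\oplus:[0,\infty]\times[0,\infty]\to[0,\infty]$ is a fixed commutative associative operation such that $0\oplus r=r$ and $r\oplus\bigwedge_{a\in A}a=\bigwedge_{a\in A}(r\oplus a)$ for all $r\in[0,\infty]$, $A\subseteq[0,\infty]$ (where $\bigwedge$ is infimum). A CAP space $(X,\lambda_X)$ is pre-approach if $\lambda_X(\bigcap_{\mathcal{F}\in\mathbb{D}}\mathcal{F})=\bigvee_{\mathcal{F}\in\mathbb{D}}\lambda_X(\mathcal{F})$ for every nonempty $\mathbb{D}\subseteq\mathbb{F}X$; it is $\oplus$-diagonal if $\lambda_X(\mathcal{S}(\mathcal{F}))\le\lambda_X(\mathcal{F})\oplus\bigvee_{a\in X}\lambda_X(\mathcal{S}(a))(a)$ for every $\mathcal{F}\in\mathbb{F}X$ and $\mathcal{S}:X\to\mathbb{F}X$. A $\oplus$-approach space is a pre-approach space that is $\oplus$-diagonal. For $A\subseteq X$ and $\epsilon\in[0,\infty]$, $A^{(\epsilon)}=\{x\in X:\exists\,\mathcal{U}\in\mathbb{U}X,\ A\in\mathcal{U},\ \lambda_X(\mathcal{U})(x)\le\epsilon\}$, and $\mathcal{F}^{(\epsilon)}=\{F^{(\epsilon)}:F\in\mathcal{F}\}$.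 A CAP space is $\oplus$-regular if $\lambda_X(\mathcal{F}^{(\epsilon)})\le\lambda_X(\mathcal{F})\oplus\epsilon$ for all $\mathcal{F}\in\mathbb{F}X$, $\epsilon\in[0,\infty]$. A subset $S\subseteq X$ is a uniformly $\oplus$-strict subspace if for every $\alpha\in[0,\infty]$ and every $\mathcal{F}\in\mathbb{F}(S^{(\alpha)})$ there is $\mathcal{G}\in\mathbb{F}S$ with $\mathcal{G}^{(\alpha)}\le\mathcal{F}$ and $\lambda_X(\mathcal{G})(x)\le\lambda_X(\mathcal{F})(x)\oplus\alpha$ for all $x\in S^{(\alpha)}$. For $S\subseteq X$, $f:S\to Y$, $x\in X$ and $\alpha,\epsilon\in[0,\infty]$: $H_S^{\epsilon}(x)=\{\mathcal{F}\in\mathbb{F}S:\lambda_X(\mathcal{F})(x)\le\epsilon\}$; $F_S^{\epsilon}(x)=\{y\in Y:\forall\mathcal{F}\in H_S^{\epsilon}(x),\ \lambda_Y(f[\mathcal{F}])(y)\le\epsilon\}$; $h(S,f,\alpha)=\{x\in S^{(\alpha)}:\bigcap_{\epsilon\in[0,\infty]}F_S^{\epsilon}(x)\ne\emptyset\}$, regarded as a subspace of $X$. For a contraction $f:S\to Y$, an admissible extension of $f$ is a function $g:h(S,f,\alpha)\to Y$ with $g_{|S}=f$ and $g(x)\in\bigcap_{\epsilon\in[0,\infty]}F_S^{\epsilon}(x)$ for each $x\in h(S,f,\alpha)$. *)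

theory Defs
  imports Complex_Main "HOL-Library.Extended_Nonnegative_Real"
begin

text \<open>
  A filter on a subset \<open>X\<close> of a type is represented by the filter it generates on the whole
  type, so that the filters on \<open>X\<close> are the proper filters \<open>F\<close> with \<open>F \<le> principal X\<close>. This
  builds in the identification of filters on a subset with filters on the ambient space; in
  particular the subspace structure on \<open>S \<subseteq> X\<close> is given by the same limit function with
  carrier \<open>S\<close>.

  Pitfall: the library orders filters by reverse inclusion (\<open>F \<le> G\<close> means that \<open>F\<close> is finer).
  Hence \<open>sup\<close> and \<open>Sup\<close> are intersections of filters, a directed \<open>Inf\<close> is a union, and
  ultrafilters are minimal. The infima over sets of a filter below are all directed, so they
  are the unions, respectively the filters generated by the bases, that they stand for; see
  \<open>eventually_adh_filter\<close> and \<open>eventually_kowalsky\<close>.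
\<close>

definition filters_on :: "'a set \<Rightarrow> 'a filter set" where
  "filters_on X = {F. F \<noteq> bot \<and> F \<le> principal X}"

definition ultrafilters_on :: "'a set \<Rightarrow> 'a filter set" where
  "ultrafilters_on X = {U \<in> filters_on X. \<forall>F \<in> filters_on X. F \<le> U \<longrightarrow> F = U}"

definition sets_of :: "'a set \<Rightarrow> 'a filter \<Rightarrow> 'a set set" where
  "sets_of X F = {A. A \<subseteq> X \<and> eventually (\<lambda>x. x \<in> A) F}"

text \<open>Only the values \<open>lam F x\<close> with \<open>F \<in> filters_on X\<close> and \<open>x \<in> X\<close> are relevant.\<close>

type_synonym 'a limfun = "'a filter \<Rightarrow> 'a \<Rightarrow> ennreal"

definition cap_space :: "'a set \<Rightarrow> 'a limfun \<Rightarrow> bool" where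
  "cap_space X lam \<longleftrightarrow>
     (\<forall>F \<in> filters_on X. \<forall>G \<in> filters_on X. \<forall>x \<in> X.
        lam (sup F G) x = max (lam F x) (lam G x)) \<and>
     (\<forall>x \<in> X. lam (principal {x}) x = 0)"

definition contraction ::
    "'a set \<Rightarrow> 'a limfun \<Rightarrow> 'b set \<Rightarrow> 'b limfun \<Rightarrow> ('a \<Rightarrow> 'b) \<Rightarrow> bool" where
  "contraction X lamX Y lamY f \<longleftrightarrow>
     f ` X \<subseteq> Y \<and>
     (\<forall>F \<in> filters_on X. \<forall>x \<in> X. lamY (filtermap f F) (f x) \<le> lamX F x)"

text \<open>With \<open>A = {}\<close> the last condition says \<open>oplus r \<infinity> = \<infinity>\<close>.\<close>

definition tensor :: "(ennreal \<Rightarrow> ennreal \<Rightarrow> ennreal) \<Rightarrow> bool" where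
  "tensor oplus \<longleftrightarrow>
     (\<forall>r s. oplus r s = oplus s r) \<and>
     (\<forall>r s t. oplus (oplus r s) t = oplus r (oplus s t)) \<and>
     (\<forall>r. oplus 0 r = r) \<and>
     (\<forall>r A. oplus r (Inf A) = (INF a\<in>A. oplus r a))"

definition pre_approach :: "'a set \<Rightarrow> 'a limfun \<Rightarrow> bool" where
  "pre_approach X lam \<longleftrightarrow>
     cap_space X lam \<and>
     (\<forall>D. D \<noteq> {} \<and> D \<subseteq> filters_on X \<longrightarrow>
        (\<forall>x \<in> X. lam (Sup D) x = (SUP F\<in>D. lam F x)))"

definition kowalsky :: "'a set \<Rightarrow> 'a filter \<Rightarrow> ('a \<Rightarrow> 'b filter) \<Rightarrow> 'b filter" where
  "kowalsky X F T = (INF A\<in>sets_of X F. SUP x\<in>A. T x)"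

definition diagonal ::
    "(ennreal \<Rightarrow> ennreal \<Rightarrow> ennreal) \<Rightarrow> 'a set \<Rightarrow> 'a limfun \<Rightarrow> bool" where
  "diagonal oplus X lam \<longleftrightarrow>
     (\<forall>F \<in> filters_on X. \<forall>T. (\<forall>a \<in> X. T a \<in> filters_on X) \<longrightarrow>
        (\<forall>x \<in> X. lam (kowalsky X F T) x \<le> oplus (lam F x) (SUP a\<in>X. lam (T a) a)))"

definition approach_space ::
    "(ennreal \<Rightarrow> ennreal \<Rightarrow> ennreal) \<Rightarrow> 'a set \<Rightarrow> 'a limfun \<Rightarrow> bool" where
  "approach_space oplus X lam \<longleftrightarrow> pre_approach X lam \<and> diagonal oplus X lam"

definition adh :: "'a set \<Rightarrow> 'a limfun \<Rightarrow> ennreal \<Rightarrow> 'a set \<Rightarrow> 'a set" where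
  "adh X lam e A =
     {x \<in> X. \<exists>U \<in> ultrafilters_on X. eventually (\<lambda>z. z \<in> A) U \<and> lam U x \<le> e}"

definition adh_filter :: "'a set \<Rightarrow> 'a limfun \<Rightarrow> ennreal \<Rightarrow> 'a filter \<Rightarrow> 'a filter" where
  "adh_filter X lam e F = (INF A\<in>sets_of X F. principal (adh X lam e A))"

definition regular ::
    "(ennreal \<Rightarrow> ennreal \<Rightarrow> ennreal) \<Rightarrow> 'a set \<Rightarrow> 'a limfun \<Rightarrow> bool" where
  "regular oplus X lam \<longleftrightarrow>
     (\<forall>F \<in> filters_on X. \<forall>e. \<forall>x \<in> X.
        lam (adh_filter X lam e F) x \<le> oplus (lam F x) e)"

definition uniformly_strict ::
    "(ennreal \<Rightarrow> ennreal \<Rightarrow> ennreal) \<Rightarrow> 'a set \<Rightarrow> 'a limfun \<Rightarrow> 'a set \<Rightarrow> bool" where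
  "uniformly_strict oplus X lam S \<longleftrightarrow>
     (\<forall>\<alpha>. \<forall>F \<in> filters_on (adh X lam \<alpha> S). \<exists>G \<in> filters_on S.
        F \<le> adh_filter X lam \<alpha> G \<and>
        (\<forall>x \<in> adh X lam \<alpha> S. lam G x \<le> oplus (lam F x) \<alpha>))"

definition H_set :: "'a limfun \<Rightarrow> 'a set \<Rightarrow> ennreal \<Rightarrow> 'a \<Rightarrow> 'a filter set" where
  "H_set lamX S e x = {F \<in> filters_on S. lamX F x \<le> e}"

definition F_set ::
    "'a limfun \<Rightarrow> 'b set \<Rightarrow> 'b limfun \<Rightarrow> 'a set \<Rightarrow> ('a \<Rightarrow> 'b) \<Rightarrow> ennreal \<Rightarrow> 'a \<Rightarrow> 'b set" where
  "F_set lamX Y lamY S f e x =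
     {y \<in> Y. \<forall>F \<in> H_set lamX S e x. lamY (filtermap f F) y \<le> e}"

definition h_set ::
    "'a set \<Rightarrow> 'a limfun \<Rightarrow> 'b set \<Rightarrow> 'b limfun \<Rightarrow> 'a set \<Rightarrow> ('a \<Rightarrow> 'b) \<Rightarrow> ennreal \<Rightarrow> 'a set" where
  "h_set X lamX Y lamY S f \<alpha> =
     {x \<in> adh X lamX \<alpha> S. (\<Inter>e. F_set lamX Y lamY S f e x) \<noteq> {}}"

definition admissible_extension ::
    "'a set \<Rightarrow> 'a limfun \<Rightarrow> 'b set \<Rightarrow> 'b limfun \<Rightarrow> 'a set \<Rightarrow> ('a \<Rightarrow> 'b) \<Rightarrow> ennreal \<Rightarrow>
     ('a \<Rightarrow> 'b) \<Rightarrow> bool" where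
  "admissible_extension X lamX Y lamY S f \<alpha> g \<longleftrightarrow>
     (\<forall>x \<in> S. g x = f x) \<and>
     (\<forall>x \<in> h_set X lamX Y lamY S f \<alpha>. g x \<in> (\<Inter>e. F_set lamX Y lamY S f e x))"

lemma sets_of_Int: "A \<in> sets_of X F \<Longrightarrow> B \<in> sets_of X F \<Longrightarrow> A \<inter> B \<in> sets_of X F"
  by (auto simp: sets_of_def eventually_conj_iff)

lemma carrier_in_sets_of: "F \<in> filters_on X \<Longrightarrow> X \<in> sets_of X F"
  by (auto simp: sets_of_def filters_on_def le_principal)

lemma adh_mono: "A \<subseteq> B \<Longrightarrow> adh X lam e A \<subseteq> adh X lam e B"
  unfolding adh_def by (blast intro: eventually_mono)

lemma eventually_adh_filter:
  assumes "F \<in> filters_on X"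
  shows "eventually P (adh_filter X lam e F) \<longleftrightarrow>
    (\<exists>A \<in> sets_of X F. \<forall>x \<in> adh X lam e A. P x)"
proof -
  have "\<exists>C \<in> sets_of X F. principal (adh X lam e C)
      \<le> inf (principal (adh X lam e A)) (principal (adh X lam e B))"
    if "A \<in> sets_of X F" "B \<in> sets_of X F" for A B
    using sets_of_Int[OF that] adh_mono[of "A \<inter> B" A X lam e] adh_mono[of "A \<inter> B" B X lam e]
    by (intro bexI[of _ "A \<inter> B"]) auto
  then show ?thesis
    unfolding adh_filter_def using carrier_in_sets_of[OF assms]
    by (subst eventually_INF_base) (auto simp: eventually_principal)
qed

lemma eventually_kowalsky:
  assumes "F \<in> filters_on X"
  shows "eventually P (kowalsky X F T) \<longleftrightarrow>
    (\<exists>A \<in> sets_of X F. \<forall>x \<in> A. eventually P (T x))"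
proof -
  have "\<exists>C \<in> sets_of X F. (SUP x\<in>C. T x) \<le> inf (SUP x\<in>A. T x) (SUP x\<in>B. T x)"
    if "A \<in> sets_of X F" "B \<in> sets_of X F" for A B
    using sets_of_Int[OF that]
    by (intro bexI[of _ "A \<inter> B"]) (auto intro!: SUP_subset_mono)
  then show ?thesis
    unfolding kowalsky_def using carrier_in_sets_of[OF assms]
    by (subst eventually_INF_base) (auto simp: eventually_Sup)
qed

end

theory Submission
  imports Defs
begin

text \<open>
  Fix a filter \<open>F\<close> on \<open>Y\<close>, a level \<open>e\<close> and a point \<open>y0\<close> that violate regularity, and put
  \<open>r = \<lambda>\<^sub>Y(F)(y0)\<close> and \<open>c = r \<oplus> e\<close>, so that \<open>\<lambda>\<^sub>Y(F\<^sup>(\<^sup>e\<^sup>))(y0) > c\<close>; in particular \<open>c\<close> is finite.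
  The space \<open>X\<close> unfolds the formation of \<open>F\<^sup>(\<^sup>e\<^sup>)\<close>. Its points are

    \<^item> a copy \<open>S\<close> of \<open>Y\<close>, consisting of isolated points;
    \<^item> for each ultrafilter \<open>U\<close> on \<open>Y\<close> and each \<open>y\<close> with \<open>\<lambda>\<^sub>Y(U)(y) \<le> e\<close> a point \<open>(U, y)\<close>, to which
      the copy of \<open>U\<close> converges at level \<open>e\<close>;
    \<^item> a point \<open>\<infinity>\<close>, to which the copy of \<open>F\<close> converges at level \<open>r\<close>, and also, at the larger
      level \<open>c\<close>, the filter \<open>G\<close> generated by the sets \<open>{(U, y). A \<in> U}\<close> with \<open>A \<in> F\<close>.

  At finite levels nothing else converges except what the principal filters and the pre-approach
  condition enforce.

  The space \<open>X\<close> is diagonal because diagonalisation makes no new filter converge to \<open>\<infinity>\<close>: a selection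
  of level at least \<open>e\<close> can replace a point \<open>(U, y)\<close> by \<open>U\<close>, or by \<open>U \<inter> {(U, y)}\<^sup>\<up>\<close>, and this turns
  \<open>G\<close> into a filter that contains the intersection of \<open>G\<close> with the copy of \<open>F\<close>, which converges to
  \<open>\<infinity>\<close> at level \<open>c\<close> anyway.

  Let \<open>f\<close> identify \<open>S\<close> with \<open>Y\<close>, and extend it by \<open>g(U, y) = y\<close> and \<open>g(\<infinity>) = y0\<close>. The filters on \<open>S\<close>
  that converge to \<open>(U, y)\<close> or to \<open>\<infinity>\<close> at a finite level are finer than \<open>U\<close> or \<open>F\<close> and so converge in \<open>Y\<close> at the required
  level; hence \<open>g\<close> is admissible. All points of \<open>X\<close> adhere to \<open>S\<close> at level \<open>c\<close>, so that \<open>g\<close> is to be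
  considered on all of \<open>X\<close> when \<open>\<alpha> = c\<close>. But \<open>g[G] = F\<^sup>(\<^sup>e\<^sup>)\<close>, while \<open>G\<close> converges to \<open>\<infinity>\<close> at level
  \<open>c\<close>: \<open>g\<close> is not a contraction (\<open>nbhd_diagonal\<close>, \<open>filtermap_project_lift\<close>).

  Uniform strictness costs nothing: in a diagonal space every subspace has it
  (\<open>diagonal_imp_uniformly_strict\<close>).
\<close>

section \<open>Ultrafilters and the filter operations\<close>

text \<open>
  A chain of proper filters is directed, so its union, which is its infimum here, is proper;
  Zorn's lemma applies.
\<close>

lemma ultrafilter_below_exists:
  assumes "F \<in> filters_on X"
  obtains U where "U \<in> ultrafilters_on X" "U \<le> F"
proof -
  let ?A = "{G. G \<noteq> bot \<and> G \<le> F}"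
  have "\<exists>M\<in>?A. \<forall>G\<in>?A. G \<le> M \<longrightarrow> G = M"
  proof (rule predicate_Zorn)
    show "partial_order_on ?A (relation_of (\<lambda>G H. H \<le> G) ?A)"
      by (auto simp: partial_order_on_def preorder_on_def relation_of_def
          intro!: refl_onI transI antisymI)
  next
    fix C assume C: "C \<in> Chains (relation_of (\<lambda>G H. H \<le> G) ?A)"
    then have CA: "G \<in> ?A" if "G \<in> C" for G
      using that by (auto simp: Chains_def relation_of_def)
    have tot: "G \<le> H \<or> H \<le> G" if "G \<in> C" "H \<in> C" for G H
      using C that by (auto simp: Chains_def relation_of_def)
    show "\<exists>M\<in>?A. \<forall>G\<in>C. M \<le> G"
    proof (cases "C = {}")
      case True
      then show ?thesis
        using assms by (auto simp: filters_on_def)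
    next
      case False
      obtain G where G: "G \<in> C"
        using False by blast
      have "eventually P (Inf C) \<longleftrightarrow> (\<exists>G\<in>C. eventually P G)" for P
      proof (rule eventually_Inf_base[OF False])
        fix G H assume "G \<in> C" "H \<in> C"
        then show "\<exists>x\<in>C. x \<le> inf G H"
          using tot[of G H] by (metis inf.absorb_iff1 inf.absorb_iff2 order_refl)
      qed
      then have "Inf C \<noteq> bot"
        using CA by (auto simp: trivial_limit_def)
      moreover have "Inf C \<le> F"
        using Inf_lower2[OF G] CA[OF G] by simp
      ultimately show ?thesis
        using Inf_lower[of _ C] by (intro bexI[of _ "Inf C"]) simp_all
    qed
  qed
  then obtain M where M: "M \<noteq> bot" "M \<le> F" "\<And>G. G \<in> ?A \<Longrightarrow> G \<le> M \<Longrightarrow> G = M"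
    by blast
  have "G = M" if "G \<noteq> bot" "G \<le> M" for G
    using M(2,3) that order_trans[OF that(2) M(2)] by simp
  moreover have "M \<le> principal X"
    using assms order_trans[OF M(2)] by (simp add: filters_on_def)
  ultimately have "M \<in> ultrafilters_on X"
    using M(1) by (simp add: ultrafilters_on_def filters_on_def)
  then show ?thesis
    using M(2) by (rule that)
qed

lemma principal_ultrafilter:
  assumes "x \<in> X"
  shows "principal {x} \<in> ultrafilters_on X"
proof -
  have "F = principal {x}" if "F \<noteq> bot" "F \<le> principal {x}" for F :: "'a filter"
  proof (rule antisym[OF that(2)], rule filter_leI)
    fix P assume "eventually P F"
    moreover have "eventually (\<lambda>z. z = x) F"
      using that(2) by (simp add: le_principal)
    ultimately have "eventually (\<lambda>z. P z \<and> z = x) F"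
      by (rule eventually_conj)
    then have "P x"
      using that(1) eventually_happens' by fastforce
    then show "eventually P (principal {x})"
      by (simp add: eventually_principal)
  qed
  then show ?thesis
    using assms by (auto simp: ultrafilters_on_def filters_on_def principal_eq_bot_iff)
qed

lemma eventually_sets_of:
  assumes "F \<in> filters_on X"
  shows "(\<exists>A\<in>sets_of X F. \<forall>x\<in>A. P x) \<longleftrightarrow> eventually P F"
proof
  assume "eventually P F"
  moreover have "eventually (\<lambda>x. x \<in> X) F"
    using assms by (simp add: filters_on_def le_principal)
  ultimately have "eventually (\<lambda>x. P x \<and> x \<in> X) F"
    by (rule eventually_conj)
  then have "{x\<in>X. P x} \<in> sets_of X F"
    by (auto simp: sets_of_def elim: eventually_mono)
  then show "\<exists>A\<in>sets_of X F. \<forall>x\<in>A. P x"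
    by (rule bexI[rotated]) simp
qed (auto simp: sets_of_def elim: eventually_mono)

lemma eventually_kowalsky_iff:
  assumes "F \<in> filters_on X"
  shows "eventually P (kowalsky X F T) \<longleftrightarrow> eventually (\<lambda>a. eventually P (T a)) F"
  by (simp add: eventually_kowalsky[OF assms] eventually_sets_of[OF assms])

lemma filters_on_mono: "X \<subseteq> Y \<Longrightarrow> filters_on X \<subseteq> filters_on Y"
  by (auto simp: filters_on_def le_principal elim!: eventually_mono)

section \<open>Quantale operations\<close>

lemma tensorD:
  assumes "tensor oplus"
  shows tensor_commute: "oplus r s = oplus s r"
    and tensor_zero: "oplus 0 r = r"
    and tensor_Inf: "oplus r (Inf A) = (INF a\<in>A. oplus r a)"
  using assms[unfolded tensor_def] by iprover+

lemma tensor_mono: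
  assumes "tensor oplus" "s \<le> t"
  shows "oplus r s \<le> oplus r t"
proof -
  have "oplus r s = inf (oplus r s) (oplus r t)"
    using tensor_Inf[OF assms(1), of r "{s, t}"] assms(2) by (simp add: inf_absorb1)
  then show ?thesis
    by (metis inf_le2)
qed

lemma tensor_upper1: "tensor oplus \<Longrightarrow> r \<le> oplus r s"
  by (metis tensor_commute tensor_mono tensor_zero zero_le)

lemma tensor_upper2: "tensor oplus \<Longrightarrow> s \<le> oplus r s"
  by (metis tensor_commute tensor_upper1)

lemma cap_space_lim_mono:
  assumes "cap_space X lam" "F \<in> filters_on X" "G \<in> filters_on X" "F \<le> G" "x \<in> X"
  shows "lam F x \<le> lam G x"
proof -
  have "lam (sup F G) x = max (lam F x) (lam G x)"
    using assms unfolding cap_space_def by blast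
  then show ?thesis
    using assms(4) by (simp add: sup.absorb2 max_def split: if_splits)
qed

section \<open>Uniform strictness in diagonal spaces\<close>

text \<open>
  Each point of \<open>S\<^sup>(\<^sup>\<alpha>\<^sup>)\<close> is, by definition, the limit at level \<open>\<alpha>\<close> of an ultrafilter on \<open>S\<close>. Diagonalising
  a filter \<open>F\<close> on \<open>S\<^sup>(\<^sup>\<alpha>\<^sup>)\<close> along such a choice gives a filter on \<open>S\<close>, whose limits are
  controlled by the diagonal axiom and whose \<open>\<alpha>\<close>-adherence lies below \<open>F\<close>.
\<close>

lemma diagonal_imp_uniformly_strict:
  assumes oplus: "tensor oplus" and cap: "cap_space X lam" and diag: "diagonal oplus X lam"
    and "S \<subseteq> X"
  shows "uniformly_strict oplus X lam S"
  unfolding uniformly_strict_def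
proof (intro allI ballI)
  fix \<alpha> F assume F: "F \<in> filters_on (adh X lam \<alpha> S)"
  have adh_X: "adh X lam \<alpha> S \<subseteq> X"
    by (auto simp: adh_def)
  then have FX: "F \<in> filters_on X"
    using F filters_on_mono by blast
  have F_adh: "eventually (\<lambda>a. a \<in> adh X lam \<alpha> S) F"
    using F by (simp add: filters_on_def le_principal)
  have "\<exists>U. U \<in> ultrafilters_on X \<and> lam U a \<le> \<alpha> \<and>
      (a \<in> adh X lam \<alpha> S \<longrightarrow> eventually (\<lambda>z. z \<in> S) U)" if "a \<in> X" for a
  proof (cases "a \<in> adh X lam \<alpha> S")
    case False
    then show ?thesis
      using cap that by (intro exI[of _ "principal {a}"])
        (auto simp: principal_ultrafilter cap_space_def)
  qed (auto simp: adh_def)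
  then obtain T where T: "\<And>a. a \<in> X \<Longrightarrow> T a \<in> ultrafilters_on X" "\<And>a. a \<in> X \<Longrightarrow> lam (T a) a \<le> \<alpha>"
    "\<And>a. a \<in> adh X lam \<alpha> S \<Longrightarrow> eventually (\<lambda>z. z \<in> S) (T a)"
    using adh_X by (metis subsetD)
  have TX: "T a \<in> filters_on X" if "a \<in> X" for a
    using T(1)[OF that] by (simp add: ultrafilters_on_def)
  define G where "G = kowalsky X F T"
  have ev_G: "eventually P G \<longleftrightarrow> eventually (\<lambda>a. eventually P (T a)) F" for P
    unfolding G_def by (rule eventually_kowalsky_iff[OF FX])
  have "G \<noteq> bot"
  proof
    assume "G = bot"
    then have "eventually (\<lambda>a. T a = bot) F"
      using ev_G[of "\<lambda>_. False"] by (simp add: trivial_limit_def)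
    then have "eventually (\<lambda>a. T a = bot \<and> a \<in> adh X lam \<alpha> S) F"
      using F_adh by (rule eventually_conj)
    then have "eventually (\<lambda>a. False) F"
      using TX adh_X by (force simp: filters_on_def elim!: eventually_mono)
    then show False
      using F by (simp add: filters_on_def trivial_limit_def)
  qed
  moreover have "eventually (\<lambda>z. z \<in> S) G"
    unfolding ev_G using F_adh by (rule eventually_mono) (rule T(3))
  ultimately have GS: "G \<in> filters_on S"
    by (simp add: filters_on_def le_principal)
  then have GX: "G \<in> filters_on X"
    using filters_on_mono[OF \<open>S \<subseteq> X\<close>] by blast
  have "F \<le> adh_filter X lam \<alpha> G"
  proof (rule filter_leI)
    fix P assume "eventually P (adh_filter X lam \<alpha> G)"
    then obtain B where B: "B \<in> sets_of X G" "\<And>x. x \<in> adh X lam \<alpha> B \<Longrightarrow> P x"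
      unfolding eventually_adh_filter[OF GX] by blast
    then have "eventually (\<lambda>a. eventually (\<lambda>z. z \<in> B) (T a)) F"
      by (simp add: sets_of_def ev_G)
    with F_adh show "eventually P F"
      by eventually_elim (use B(2) T(1,2) adh_X in \<open>auto simp: adh_def\<close>)
  qed
  moreover have "lam G x \<le> oplus (lam F x) \<alpha>" if "x \<in> adh X lam \<alpha> S" for x
  proof -
    have "lam G x \<le> oplus (lam F x) (SUP a\<in>X. lam (T a) a)"
      using diag FX TX that adh_X unfolding diagonal_def G_def by blast
    also have "\<dots> \<le> oplus (lam F x) \<alpha>"
      using T(2) by (intro tensor_mono[OF oplus] SUP_least)
    finally show ?thesis .
  qed
  ultimately show "\<exists>G\<in>filters_on S. F \<le> adh_filter X lam \<alpha> G \<and>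
      (\<forall>x\<in>adh X lam \<alpha> S. lam G x \<le> oplus (lam F x) \<alpha>)"
    using GS by blast
qed

section \<open>Limit functions given by neighbourhood filters\<close>

text \<open>
  Pre-approach spaces are those whose limit function comes from neighbourhood filters \<open>N t x\<close>, one
  for each level. In this form the supremum condition is formal, and only finite levels matter
  for the diagonal axiom.
\<close>

lemma pre_approach_nbhd:
  assumes lam: "\<And>F x t. x \<in> X \<Longrightarrow> lam F x \<le> t \<longleftrightarrow> F \<le> N t x"
    and point: "\<And>x. x \<in> X \<Longrightarrow> principal {x} \<le> N 0 x"
  shows "pre_approach X lam"
proof -
  have Sup: "lam (Sup D) x = (SUP F\<in>D. lam F x)" if "x \<in> X" for D x
  proof (rule antisym)
    show "lam (Sup D) x \<le> (SUP F\<in>D. lam F x)"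
      unfolding lam[OF that] by (rule Sup_least, unfold lam[OF that, symmetric], rule SUP_upper)
    have "Sup D \<le> N (lam (Sup D) x) x"
      by (simp add: lam[OF that, symmetric])
    then show "(SUP F\<in>D. lam F x) \<le> lam (Sup D) x"
      by (intro SUP_least) (simp add: lam[OF that] Sup_le_iff)
  qed
  have "lam (sup F G) x = max (lam F x) (lam G x)" if "x \<in> X" for F G x
    using Sup[OF that, of "{F, G}"] by (simp add: sup_max)
  moreover have "lam (principal {x}) x = 0" if "x \<in> X" for x
    using lam[OF that] point[OF that] by (metis le_zero_eq)
  ultimately show ?thesis
    using Sup unfolding pre_approach_def cap_space_def by blast
qed

lemma diagonal_nbhd:
  assumes oplus: "tensor oplus"
    and lam: "\<And>F x t. x \<in> X \<Longrightarrow> lam F x \<le> t \<longleftrightarrow> F \<le> N t x"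
    and N: "\<And>s t x T P. x \<in> X \<Longrightarrow> oplus s t \<noteq> \<infinity> \<Longrightarrow> (\<And>a. a \<in> X \<Longrightarrow> T a \<le> N t a) \<Longrightarrow>
      eventually P (N (oplus s t) x) \<Longrightarrow> eventually (\<lambda>a. eventually P (T a)) (N s x)"
  shows "diagonal oplus X lam"
  unfolding diagonal_def
proof (intro ballI allI impI)
  fix F T x assume F: "F \<in> filters_on X" and "\<forall>a\<in>X. T a \<in> filters_on X" and x: "x \<in> X"
  let ?s = "lam F x" and ?t = "SUP a\<in>X. lam (T a) a"
  show "lam (kowalsky X F T) x \<le> oplus ?s ?t"
  proof (cases "oplus ?s ?t = \<infinity>")
    case False
    have "T a \<le> N ?t a" if "a \<in> X" for a
      using that lam[OF that, of "T a" ?t, symmetric] by (auto intro: SUP_upper)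
    moreover have "F \<le> N ?s x"
      using lam[OF x] by blast
    ultimately have "kowalsky X F T \<le> N (oplus ?s ?t) x"
      using N[OF x False] by (intro filter_leI) (auto simp: eventually_kowalsky_iff[OF F] le_filter_def)
    then show ?thesis
      by (simp add: lam[OF x])
  qed simp
qed

section \<open>The space unfolding a failure of regularity\<close>

locale irregular_filter =
  fixes oplus :: "ennreal \<Rightarrow> ennreal \<Rightarrow> ennreal"
    and Y :: "'b set" and lamY :: "'b limfun"
    and F :: "'b filter" and e :: ennreal and y0 :: 'b
  assumes oplus: "tensor oplus"
    and Y: "cap_space Y lamY"
    and F: "F \<in> filters_on Y"
    and y0: "y0 \<in> Y"
    and irregular: "oplus (lamY F y0) e < lamY (adh_filter Y lamY e F) y0"
begin

definition r :: ennreal where "r = lamY F y0"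

definition c :: ennreal where "c = oplus r e"

definition adherences :: "('b filter \<times> 'b) set" where
  "adherences = {(U, y). U \<in> ultrafilters_on Y \<and> y \<in> Y \<and> lamY U y \<le> e}"

definition copy :: "'b \<Rightarrow> ('b + 'b filter \<times> 'b) option" where
  "copy y = Some (Inl y)"

definition node :: "'b filter \<times> 'b \<Rightarrow> ('b + 'b filter \<times> 'b) option" where
  "node p = Some (Inr p)"

definition X :: "('b + 'b filter \<times> 'b) option set" where
  "X = copy ` Y \<union> node ` adherences \<union> {None}"

definition S :: "('b + 'b filter \<times> 'b) option set" where
  "S = copy ` Y"

text \<open>
  The filter \<open>G\<close>: each member of \<open>F\<close> is replaced by the adherence pairs that witness its
  adherence of level \<open>e\<close>.
\<close>

definition lift :: "('b + 'b filter \<times> 'b) option filter" where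
  "lift = (INF A\<in>sets_of Y F.
     principal {node (U, y) |U y. (U, y) \<in> adherences \<and> eventually (\<lambda>z. z \<in> A) U})"

text \<open>
  The map \<open>g\<close>; its restriction to \<open>S\<close> is \<open>f\<close>, so that it is used for both.
\<close>

definition project :: "('b + 'b filter \<times> 'b) option \<Rightarrow> 'b" where
  "project x = (case x of None \<Rightarrow> y0 | Some (Inl y) \<Rightarrow> y | Some (Inr p) \<Rightarrow> snd p)"

text \<open>
  The coarsest filter that converges to \<open>x\<close> at level \<open>t\<close>. Each \<open>bot\<close> contributes nothing, as
  \<open>sup\<close> intersects filters; at the level \<open>\<infinity>\<close> every filter converges.
\<close>

definition nbhd :: "ennreal \<Rightarrow> ('b + 'b filter \<times> 'b) option \<Rightarrow> ('b + 'b filter \<times> 'b) option filter" where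
  "nbhd t x = (if t = \<infinity> then top else sup (principal {x}) (case x of
      None \<Rightarrow> sup (if r \<le> t then filtermap copy F else bot) (if c \<le> t then lift else bot)
    | Some (Inl y) \<Rightarrow> bot
    | Some (Inr (U, y)) \<Rightarrow> if e \<le> t then filtermap copy U else bot))"

definition lam :: "('b + 'b filter \<times> 'b) option limfun" where
  "lam G x = Inf {t. G \<le> nbhd t x}"

lemma c_finite: "c < \<infinity>"
  using order_less_le_trans[OF irregular top_greatest] by (simp add: c_def r_def)

lemma r_le_c: "r \<le> c" and e_le_c: "e \<le> c"
  unfolding c_def using tensor_upper1 tensor_upper2 oplus by blast+

lemma adherencesD:
  assumes "(U, y) \<in> adherences"
  shows "U \<in> filters_on Y" "y \<in> Y" "lamY U y \<le> e"
  using assms by (auto simp: adherences_def ultrafilters_on_def)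

lemma S_subset_X: "S \<subseteq> X"
  by (auto simp: S_def X_def)

lemma eventually_lift:
  "eventually P lift \<longleftrightarrow> (\<exists>A\<in>sets_of Y F. \<forall>U y. (U, y) \<in> adherences \<longrightarrow>
     eventually (\<lambda>z. z \<in> A) U \<longrightarrow> P (node (U, y)))"
proof -
  let ?B = "\<lambda>A. {node (U, y) |U y. (U, y) \<in> adherences \<and> eventually (\<lambda>z. z \<in> A) U}"
  have "\<exists>C\<in>sets_of Y F. principal (?B C) \<le> inf (principal (?B A)) (principal (?B A'))"
    if "A \<in> sets_of Y F" "A' \<in> sets_of Y F" for A A'
    using sets_of_Int[OF that] by (intro bexI[of _ "A \<inter> A'"]) (auto simp: eventually_conj_iff)
  then have "eventually P lift \<longleftrightarrow> (\<exists>A\<in>sets_of Y F. eventually P (principal (?B A)))"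
    unfolding lift_def using carrier_in_sets_of[OF F] by (intro eventually_INF_base) blast+
  moreover have "eventually P (principal (?B A)) \<longleftrightarrow> (\<forall>U y. (U, y) \<in> adherences \<longrightarrow>
      eventually (\<lambda>z. z \<in> A) U \<longrightarrow> P (node (U, y)))" for A
    unfolding eventually_principal by blast
  ultimately show ?thesis
    by simp
qed

text \<open>
  The points \<open>y\<close> of the pairs with \<open>A \<in> U\<close> are exactly those of \<open>A\<^sup>(\<^sup>e\<^sup>)\<close>.
\<close>

lemma filtermap_project_lift: "filtermap project lift = adh_filter Y lamY e F"
proof (rule filter_eqI)
  fix P
  have "(\<forall>x\<in>adh Y lamY e A. P x) \<longleftrightarrow> (\<forall>U y. (U, y) \<in> adherences \<longrightarrow>
      eventually (\<lambda>z. z \<in> A) U \<longrightarrow> P (project (node (U, y))))" for A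
    by (auto simp: adh_def adherences_def project_def node_def)
  then show "eventually P (filtermap project lift) \<longleftrightarrow> eventually P (adh_filter Y lamY e F)"
    by (simp add: eventually_filtermap eventually_lift eventually_adh_filter[OF F])
qed

lemma lift_in_filters_on_X: "lift \<in> filters_on X"
proof -
  have "\<not> eventually (\<lambda>_. False) lift"
  proof
    assume "eventually (\<lambda>_. False) lift"
    then obtain A where A: "A \<in> sets_of Y F"
      "\<And>U y. (U, y) \<in> adherences \<Longrightarrow> \<not> eventually (\<lambda>z. z \<in> A) U"
      unfolding eventually_lift by blast
    have "A \<noteq> {}"
      using A(1) F by (auto simp: sets_of_def filters_on_def trivial_limit_def)
    then obtain a where "a \<in> A"
      by blast
    moreover from this have "a \<in> Y"
      using A(1) by (auto simp: sets_of_def)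
    ultimately have "(principal {a}, a) \<in> adherences"
      using Y by (auto simp: adherences_def principal_ultrafilter cap_space_def)
    from A(2)[OF this] \<open>a \<in> A\<close> show False
      by (simp add: eventually_principal)
  qed
  moreover have "eventually (\<lambda>x. x \<in> X) lift"
    using carrier_in_sets_of[OF F] unfolding eventually_lift X_def by blast
  ultimately show ?thesis
    by (simp add: filters_on_def le_principal trivial_limit_def)
qed

lemma copy_filter: "G \<in> filters_on Y \<Longrightarrow> filtermap copy G \<in> filters_on S"
  by (auto simp: filters_on_def filtermap_bot_iff le_principal eventually_filtermap S_def
      elim: eventually_mono)

lemma nbhd_None:
  "nbhd t None = (if t = \<infinity> then top else sup (principal {None})
     (sup (if r \<le> t then filtermap copy F else bot) (if c \<le> t then lift else bot)))"
  and nbhd_copy: "nbhd t (copy y) = (if t = \<infinity> then top else principal {copy y})"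
  and nbhd_node: "nbhd t (node (U, y)) = (if t = \<infinity> then top else
     sup (principal {node (U, y)}) (if e \<le> t then filtermap copy U else bot))"
  by (simp_all add: nbhd_def copy_def node_def)

lemma principal_le_nbhd: "principal {x} \<le> nbhd t x"
  by (simp add: nbhd_def)

text \<open>
  The neighbourhoods of a point are a step function of the level, with jumps only at \<open>e\<close>, \<open>r\<close>, \<open>c\<close>
  and \<open>\<infinity>\<close>, and at a jump they take the upper value. So the infimum that defines \<open>lam\<close> is attained;
  \<open>v\<close> below is its value, the first of these levels, or \<open>0\<close>, at which \<open>G\<close> converges.
\<close>

lemma lam_le_iff:
  "lam G x \<le> t \<longleftrightarrow> G \<le> nbhd t x"
proof -
  have "\<exists>v. \<forall>t. G \<le> nbhd t x \<longleftrightarrow> v \<le> t"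
  proof (cases "G \<le> principal {x}")
    case True
    then have "G \<le> nbhd t x" for t
      using principal_le_nbhd order_trans by blast
    then show ?thesis
      by (intro exI[of _ 0]) simp
  next
    case x: False
    show ?thesis
    proof (cases x)
      case None
      let ?N = "sup (principal {None}) (filtermap copy F)"
      show ?thesis
      proof (cases "G \<le> ?N")
        case True
        then have "G \<le> sup (principal {None}) (sup (filtermap copy F) lift)"
          by (rule order_trans) (simp add: le_supI2)
        with True show ?thesis
          using x r_le_c None by (intro exI[of _ r])
            (auto simp: nbhd_None dest: order_trans top_le)
      next
        case False
        show ?thesis
        proof (cases "G \<le> sup (principal {None}) (sup (filtermap copy F) lift)")
          case True
          with False show ?thesis
            using x r_le_c None by (intro exI[of _ c])
              (auto simp: nbhd_None top_unique dest: order_trans)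
        next
          case False': False
          with False show ?thesis
            using x r_le_c None by (intro exI[of _ \<infinity>])
              (auto simp: nbhd_None top_unique dest: order_trans)
        qed
      qed
    next
      case (Some z)
      show ?thesis
      proof (cases z)
        case (Inl y)
        then show ?thesis
          using x Some by (intro exI[of _ \<infinity>]) (auto simp: nbhd_def top_unique)
      next
        case (Inr p)
        then show ?thesis
          using x Some
          by (intro exI[of _ "if G \<le> sup (principal {x}) (filtermap copy (fst p)) then e else \<infinity>"])
            (auto simp: nbhd_def top_unique split: prod.splits)
      qed
    qed
  qed
  then obtain v where "\<And>t. G \<le> nbhd t x \<longleftrightarrow> v \<le> t"
    by blast
  moreover from this have "lam G x = v"
    unfolding lam_def by (intro antisym Inf_greatest Inf_lower) auto
  ultimately show ?thesis
    by simp
qed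

lemma nbhd_mono: "s \<le> t \<Longrightarrow> nbhd s x \<le> nbhd t x"
  using lam_le_iff order_refl order_trans by metis

text \<open>
  This is the diagonal axiom for \<open>X\<close>. The principal part of a neighbourhood filter poses no problem, nor
  does the copy of a filter on \<open>Y\<close>, since its points are isolated. For \<open>lift\<close> at \<open>\<infinity>\<close>: \<open>P\<close> holds on the copy of
  some \<open>A \<in> F\<close> and on the pairs \<open>(U, y)\<close> with \<open>B \<in> U\<close>, for some \<open>B \<in> F\<close>. If \<open>A \<inter> B \<in> U\<close>, then \<open>P\<close>
  holds at \<open>(U, y)\<close> and along the copy of \<open>U\<close>, hence along every filter that has a finite limit
  at \<open>(U, y)\<close>.
\<close>

lemma nbhd_diagonal:
  assumes x: "x \<in> X" and finite: "oplus s t \<noteq> \<infinity>" and T: "\<And>a. a \<in> X \<Longrightarrow> T a \<le> nbhd t a"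
    and P: "eventually P (nbhd (oplus s t) x)"
  shows "eventually (\<lambda>a. eventually P (T a)) (nbhd s x)"
proof -
  have s: "s \<le> oplus s t" and t: "t \<le> oplus s t"
    using tensor_upper1 tensor_upper2 oplus by blast+
  with finite have fin: "s \<noteq> \<infinity>" "t \<noteq> \<infinity>"
    by (auto simp: top_unique)
  have P_s: "eventually P (nbhd s x)"
    using P nbhd_mono[OF s] by (auto simp: le_filter_def)
  have at_x: "eventually P (T x)"
    using P order_trans[OF T[OF x] nbhd_mono[OF t]] by (auto simp: le_filter_def)
  have at_copy: "eventually P (T (copy y))" if "y \<in> Y" "P (copy y)" for y
    using T[of "copy y"] that fin
    by (auto simp: X_def nbhd_copy le_filter_def eventually_principal)
  have along_copy: "eventually (\<lambda>a. eventually P (T a)) (filtermap copy U)"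
    if "U \<in> filters_on Y" "eventually P (filtermap copy U)" for U
  proof -
    have "eventually (\<lambda>y. y \<in> Y) U" "eventually (\<lambda>y. P (copy y)) U"
      using that by (simp_all add: filters_on_def le_principal eventually_filtermap)
    then show ?thesis
      unfolding eventually_filtermap by eventually_elim (rule at_copy)
  qed
  have along_lift: "eventually (\<lambda>a. eventually P (T a)) lift"
    if P_F: "eventually P (filtermap copy F)" and P_lift: "eventually P lift"
  proof -
    have "eventually (\<lambda>y. P (copy y)) F"
      using P_F by (simp add: eventually_filtermap)
    then obtain A where A: "A \<in> sets_of Y F" "\<And>y. y \<in> A \<Longrightarrow> P (copy y)"
      unfolding eventually_sets_of[OF F, symmetric] by blast
    obtain B where B: "B \<in> sets_of Y F"
      "\<And>U y. (U, y) \<in> adherences \<Longrightarrow> eventually (\<lambda>z. z \<in> B) U \<Longrightarrow> P (node (U, y))"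
      using P_lift unfolding eventually_lift by blast
    have "eventually P (T (node (U, y)))"
      if "(U, y) \<in> adherences" "eventually (\<lambda>z. z \<in> A \<inter> B) U" for U y
    proof -
      have "eventually (\<lambda>z. P (copy z)) U" "P (node (U, y))"
        using that A(2) B(2) by (auto simp: eventually_conj_iff elim: eventually_mono)
      then have "eventually P (nbhd t (node (U, y)))"
        using fin by (simp add: nbhd_node eventually_sup eventually_principal eventually_filtermap)
      then show ?thesis
        using T[of "node (U, y)"] that(1) by (auto simp: X_def le_filter_def)
    qed
    then show ?thesis
      unfolding eventually_lift using sets_of_Int[OF A(1) B(1)] by blast
  qed
  consider "x = None" | y where "x = copy y" | U y where "x = node (U, y)" "(U, y) \<in> adherences"
    using x by (auto simp: X_def)
  then show ?thesis
  proof cases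
    case 1
    then show ?thesis
      using fin P_s at_x along_copy[OF F] along_lift r_le_c
      by (auto simp: nbhd_None eventually_sup eventually_principal split: if_splits)
  next
    case 2
    then show ?thesis
      using fin at_x by (simp add: nbhd_copy eventually_principal)
  next
    case 3
    then show ?thesis
      using fin P_s at_x along_copy adherencesD(1)
      by (auto simp: nbhd_node eventually_sup eventually_principal)
  qed
qed

lemma approach_space_X: "approach_space oplus X lam"
  unfolding approach_space_def
proof
  show "pre_approach X lam"
    using lam_le_iff principal_le_nbhd by (intro pre_approach_nbhd[where N = nbhd])
  show "diagonal oplus X lam"
    using oplus lam_le_iff by (rule diagonal_nbhd[where N = nbhd]) (rule nbhd_diagonal)
qed

lemma uniformly_strict_S: "uniformly_strict oplus X lam S"
  using approach_space_X S_subset_X oplus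
  by (intro diagonal_imp_uniformly_strict) (auto simp: approach_space_def pre_approach_def)

section \<open>The admissible extension\<close>

lemma project_simps [simp]:
  "project None = y0" "project (copy y) = y" "project (node p) = snd p"
  by (simp_all add: project_def copy_def node_def)

text \<open>
  This one inequality, for points \<open>x\<close> of \<open>X\<close> that may lie outside \<open>S\<close>, contains both that \<open>project\<close> is a
  contraction on \<open>S\<close> and that it is admissible. It holds because of a neighbourhood filter only the part on \<open>S\<close>
  matters for a filter on \<open>S\<close>; so \<open>lift\<close>, which breaks the contraction on \<open>X\<close>, is invisible here.
\<close>

lemma lamY_project_le:
  assumes G: "G \<in> filters_on S" and x: "x \<in> X"
  shows "lamY (filtermap project G) (project x) \<le> lam G x"
proof (cases "lam G x = \<infinity>")
  case fin: False
  have G_nbhd: "G \<le> nbhd (lam G x) x"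
    using lam_le_iff by blast
  have G_S: "eventually (\<lambda>z. z \<in> S) G" and "G \<noteq> bot"
    using G by (simp_all add: filters_on_def le_principal)
  have fmap: "filtermap project G \<in> filters_on Y"
    using G_S \<open>G \<noteq> bot\<close>
    by (auto simp: filters_on_def filtermap_bot_iff le_principal eventually_filtermap S_def
        elim!: eventually_mono)
  \<comment> \<open>The condition on \<open>N\<close> says that its trace on \<open>S\<close> is finer than the copy of \<open>U\<close>.\<close>
  have finer: "filtermap project G \<le> U"
    if "G \<le> N" and "\<And>P. eventually P U \<Longrightarrow> eventually (\<lambda>z. z \<in> S \<longrightarrow> P (project z)) N" for U N
  proof (rule filter_leI)
    fix P assume "eventually P U"
    then have "eventually (\<lambda>z. z \<in> S \<longrightarrow> P (project z)) G"
      using that by (auto simp: le_filter_def)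
    with G_S show "eventually P (filtermap project G)"
      unfolding eventually_filtermap by eventually_elim simp
  qed
  have outside: "None \<notin> S" "node p \<notin> S" for p
    by (auto simp: S_def copy_def node_def)
  have empty: False if "G \<le> N" "eventually (\<lambda>z. z \<notin> S) N" for N
  proof -
    have "eventually (\<lambda>z. z \<notin> S) G"
      using that by (auto simp: le_filter_def)
    with G_S have "eventually (\<lambda>z. False) G"
      by eventually_elim simp
    with \<open>G \<noteq> bot\<close> show False
      by (simp add: trivial_limit_def)
  qed
  consider "x = None" | y where "x = copy y" "y \<in> Y"
    | U y where "x = node (U, y)" "(U, y) \<in> adherences"
    using x by (auto simp: X_def)
  then show ?thesis
  proof cases
    case 1
    have ev_lift: "eventually (\<lambda>z. z \<notin> S) lift"
      unfolding eventually_lift using carrier_in_sets_of[OF F] outside by blast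
    have "r \<le> lam G x"
    \<comment> \<open>Below level \<open>r\<close> only the principal filter at \<open>\<infinity>\<close> converges to \<open>\<infinity>\<close>, and it is not on \<open>S\<close>.\<close>
    proof (rule ccontr)
      assume "\<not> r \<le> lam G x"
      then have "eventually (\<lambda>z. z \<notin> S) (nbhd (lam G x) x)"
        using 1 fin ev_lift outside
        by (simp add: nbhd_None eventually_sup eventually_principal)
      then show False
        by (rule empty[OF G_nbhd])
    qed
    moreover have "filtermap project G \<le> F"
    proof (rule finer[OF G_nbhd])
      fix P assume "eventually P F"
      then show "eventually (\<lambda>z. z \<in> S \<longrightarrow> P (project z)) (nbhd (lam G x) x)"
        using 1 fin ev_lift outside
        by (auto simp: nbhd_None eventually_sup eventually_principal eventually_filtermap
            elim: eventually_mono)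
    qed
    ultimately show ?thesis
      using cap_space_lim_mono[OF Y fmap F _ y0] 1 by (auto simp: r_def intro: order_trans)
  next
    case 2
    have "filtermap project G \<le> principal {y}"
      by (rule finer[OF G_nbhd]) (use 2 fin in \<open>auto simp: nbhd_copy eventually_principal\<close>)
    moreover have "principal {y} \<in> filters_on Y" "lamY (principal {y}) y = 0"
      using 2 Y principal_ultrafilter[of y Y] by (auto simp: ultrafilters_on_def cap_space_def)
    ultimately show ?thesis
      using cap_space_lim_mono[OF Y fmap] 2 by fastforce
  next
    case 3
    have "e \<le> lam G x"
    proof (rule ccontr)
      assume "\<not> e \<le> lam G x"
      then have "eventually (\<lambda>z. z \<notin> S) (nbhd (lam G x) x)"
        using 3 fin outside by (simp add: nbhd_node eventually_principal)
      then show False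
        by (rule empty[OF G_nbhd])
    qed
    moreover have "filtermap project G \<le> U"
    proof (rule finer[OF G_nbhd])
      fix P assume "eventually P U"
      then show "eventually (\<lambda>z. z \<in> S \<longrightarrow> P (project z)) (nbhd (lam G x) x)"
        using 3 fin outside
        by (auto simp: nbhd_node eventually_sup eventually_principal eventually_filtermap
            elim: eventually_mono)
    qed
    ultimately have "lamY (filtermap project G) y \<le> lam G x"
      using cap_space_lim_mono[OF Y fmap, of U y] adherencesD[OF 3(2)] by (meson order_trans)
    then show ?thesis
      using 3 by simp
  qed
qed simp

lemma project_in_Y: "x \<in> X \<Longrightarrow> project x \<in> Y"
  using y0 by (auto simp: X_def adherencesD)

lemma contraction_project: "contraction S lam Y lamY project"
  unfolding contraction_def using lamY_project_le project_in_Y S_subset_X by blast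

lemma project_in_F_set: "x \<in> X \<Longrightarrow> project x \<in> (\<Inter>s. F_set lam Y lamY S project s x)"
  using lamY_project_le project_in_Y by (auto simp: F_set_def H_set_def intro: order_trans)

text \<open>
  At \<open>(U, y)\<close> and at \<open>\<infinity>\<close> an ultrafilter finer than the copy of \<open>U\<close> or of \<open>F\<close> shows this. The level
  \<open>c\<close> is chosen so as to dominate both \<open>e\<close> and \<open>r\<close>.
\<close>

lemma adh_S: "adh X lam c S = X"
proof
  show "X \<subseteq> adh X lam c S"
  proof
    fix x assume x: "x \<in> X"
    have witness: "x \<in> adh X lam c S" if "G \<in> filters_on S" "G \<le> nbhd c x" for G
    proof -
      have "G \<in> filters_on X"
        using that(1) filters_on_mono[OF S_subset_X] by blast
      then obtain U where U: "U \<in> ultrafilters_on X" "U \<le> G"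
        by (rule ultrafilter_below_exists)
      have "U \<le> principal S" "U \<le> nbhd c x"
        using that order_trans[OF U(2)] by (simp_all add: filters_on_def)
      then have "eventually (\<lambda>z. z \<in> S) U" "lam U x \<le> c"
        by (simp_all add: le_principal lam_le_iff)
      with U x show ?thesis
        by (auto simp: adh_def)
    qed
    consider "x = None" | y where "x = copy y" "y \<in> Y"
      | U y where "x = node (U, y)" "(U, y) \<in> adherences"
      using x by (auto simp: X_def)
    then show "x \<in> adh X lam c S"
    proof cases
      case 1
      then show ?thesis
        using r_le_c by (intro witness[OF copy_filter[OF F]]) (auto simp: nbhd_None le_supI1 le_supI2)
    next
      case 2
      then show ?thesis
        using principal_le_nbhd
        by (intro witness[of "principal {x}"]) (auto simp: filters_on_def S_def principal_eq_bot_iff)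
    next
      case 3
      then show ?thesis
        using e_le_c by (intro witness[OF copy_filter[OF adherencesD(1)[OF 3(2)]]])
          (auto simp: nbhd_node)
    qed
  qed
qed (auto simp: adh_def)

lemma h_set_S: "h_set X lam Y lamY S project c = X"
  using project_in_F_set unfolding h_set_def adh_S by blast

lemma admissible_extension_project: "admissible_extension X lam Y lamY S project c project"
  unfolding admissible_extension_def h_set_S using project_in_F_set by blast

lemma not_contraction_project: "\<not> contraction X lam Y lamY project"
proof
  assume "contraction X lam Y lamY project"
  moreover have "None \<in> X"
    by (simp add: X_def)
  ultimately have "lamY (adh_filter Y lamY e F) y0 \<le> lam lift None"
    using lift_in_filters_on_X
    by (metis contraction_def filtermap_project_lift project_simps(1))
  also have "\<dots> \<le> c"
    unfolding lam_le_iff by (simp add: nbhd_None le_supI2)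
  finally show False
    using irregular by (simp add: c_def r_def)
qed

end

theorem theorem11:
  fixes oplus :: "ennreal \<Rightarrow> ennreal \<Rightarrow> ennreal"
    and Y :: "'b set" and lamY :: "'b limfun"
  assumes "tensor oplus"
    and "cap_space Y lamY"
    and "\<not> regular oplus Y lamY"
  shows "\<exists>(X :: ('b + 'b filter \<times> 'b) option set) lamX S f \<alpha> g.
           approach_space oplus X lamX \<and>
           S \<subseteq> X \<and> uniformly_strict oplus X lamX S \<and>
           contraction S lamX Y lamY f \<and>
           \<alpha> < \<infinity> \<and>
           admissible_extension X lamX Y lamY S f \<alpha> g \<and>
           \<not> contraction (h_set X lamX Y lamY S f \<alpha>) lamX Y lamY g"
proof -
  from assms(3) obtain F e y0 where "F \<in> filters_on Y" "y0 \<in> Y"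
    "oplus (lamY F y0) e < lamY (adh_filter Y lamY e F) y0"
    by (auto simp: regular_def not_le)
  with assms interpret irregular_filter oplus Y lamY F e y0
    by unfold_locales
  show ?thesis
    using approach_space_X S_subset_X uniformly_strict_S contraction_project c_finite
      admissible_extension_project not_contraction_project h_set_S by metis
qed

end
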